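(* Let $A$ and $B$ be commutative rings with nonzero identity and let $f:A\to B$ be a surjective ring homomorphism such that $\ker(f)\subseteq\operatorname{Nil}(A)$. Then taking preimages induces an order embedding \[ \Phi_f:\mathcal R_{\mathrm{pr}}(B)\longrightarrow\mathcal R_{\mathrm{pr}}(A),\qquad J\longmapsto f^{-1}(J). \] Equivalently, under the identifications $KQ(GD(R))\cong\mathcal R_{\mathrm{pr}}(R)$ (for $R=A,B$), $f$ induces a topological embedding $KQ(GD(B))\to KQ(GD(A))$. Moreover, the image of $\Phi_f$ contains every element of $\mathcal R_{\mathrm{pr}}(A)$ except possibly $\operatorname{Nil}(A)$. More precisely: (1) if $A$ is reduced or $B$ is not reduced, then $\Phi_f$ is surjective; (2) if $A$ is not reduced and $B$ is reduced, then $\operatorname{Im}(\Phi_f)=\mathcal R_{\mathrm{pr}}(A)\setminus\{\operatorname{Nil}(A)\}$.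
   Context: For a commutative ring $R$ with nonzero identity and unit group $U(R)$, let $R^\#=R\setminus(U(R)\cup\{0\})$ be the set of nonzero nonunits. For $a,b\in R^\#$ write $a\sim b$ if $aR=bR$; $[a]$ denotes the equivalence class of $a$ and $EC(R^\#)$ the set of equivalence classes. For $a\in R^\#$ put $B_a=\{[b]\in EC(R^\#): b\mid a^n\text{ for some }n\geq 1\}$. The sets $B_a$ ($a\in R^\#$) form a basis of a topology on $EC(R^\#)$; the resulting space is denoted $GD(R)$ (the generalized divisor topology). $\mathcal R_{\mathrm{pr}}(R)=\{\sqrt{aR}:a\in R^\#\}$ is ordered by inclusion and carries the upper Alexandrov topology, whose open sets are exactly the upper sets. $KQ(X)$ denotes the Kolmogorov quotient of a space $X$: the quotient space identifying points having the same open neighbourhoods. The identification $KQ(GD(R))\cong\mathcal R_{\mathrm{pr}}(R)$ is the homeomorphism sending the class of $[a]$ to $\sqrt{aR}$. $\operatorname{Nil}(R)$ is the nilradical of $R$; $R$ is reduced if $\operatorname{Nil}(R)=0$. An order embedding is a map $\phi$ of posets with $x\leq y\Leftrightarrow\phi(x)\leq\phi(y)$. *)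

theory Defs
  imports
    "HOL-Algebra.RingHom"
    "HOL-Algebra.Divisibility"
    "HOL-Analysis.Abstract_Topological_Spaces"
begin

section \<open>Radicals\<close>

definition radical :: "('a, 'm) ring_scheme \<Rightarrow> 'a set \<Rightarrow> 'a set" where
  "radical R I = {x \<in> carrier R. \<exists>n::nat. n \<ge> 1 \<and> x [^]\<^bsub>R\<^esub> n \<in> I}"

definition nilradical :: "('a, 'm) ring_scheme \<Rightarrow> 'a set" where
  "nilradical R = radical R {\<zero>\<^bsub>R\<^esub>}"

definition reduced_ring :: "('a, 'm) ring_scheme \<Rightarrow> bool" where
  "reduced_ring R \<longleftrightarrow> nilradical R = {\<zero>\<^bsub>R\<^esub>}"

definition nonzero_nonunits :: "('a, 'm) ring_scheme \<Rightarrow> 'a set" where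
  "nonzero_nonunits R = carrier R - (Units R \<union> {\<zero>\<^bsub>R\<^esub>})"

definition principal_radicals :: "('a, 'm) ring_scheme \<Rightarrow> 'a set set" where
  "principal_radicals R = {radical R (PIdl\<^bsub>R\<^esub> a) | a. a \<in> nonzero_nonunits R}"


section \<open>The generalized divisor topology\<close>

definition assoc_class :: "('a, 'm) ring_scheme \<Rightarrow> 'a \<Rightarrow> 'a set" where
  "assoc_class R a = {b \<in> nonzero_nonunits R. PIdl\<^bsub>R\<^esub> a = PIdl\<^bsub>R\<^esub> b}"

definition EC :: "('a, 'm) ring_scheme \<Rightarrow> 'a set set" where
  "EC R = assoc_class R ` nonzero_nonunits R"

definition GD_basic :: "('a, 'm) ring_scheme \<Rightarrow> 'a \<Rightarrow> 'a set set" where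
  "GD_basic R a =
     {assoc_class R b | b. b \<in> nonzero_nonunits R \<and> (\<exists>n::nat. n \<ge> 1 \<and> b divides\<^bsub>R\<^esub> (a [^]\<^bsub>R\<^esub> n))}"

text \<open>The sets \<open>GD_basic R a\<close> are not merely a subbasis but a basis: see \<open>GD_basis\<close> below.\<close>

definition GD :: "('a, 'm) ring_scheme \<Rightarrow> 'a set topology" where
  "GD R = topology_generated_by (GD_basic R ` nonzero_nonunits R)"


section \<open>Kolmogorov quotients\<close>

text \<open>
  The library realises the Kolmogorov quotient of \<open>X\<close> on a system of representatives: the map
  \<open>Kolmogorov_quotient X\<close> sends a point to the chosen representative of its class of
  topologically indistinguishable points, and it is a quotient map onto the following space
  (\<open>quotient_map_Kolmogorov_quotient\<close>).
\<close>

definition KQ :: "'a topology \<Rightarrow> 'a topology" where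
  "KQ X = subtopology X (Kolmogorov_quotient X ` topspace X)"

text \<open>
  The identification of \<open>KQ (GD R)\<close> with the principal radicals, sending the class of
  \<open>[a]\<close> to the radical of \<open>aR\<close>. That it is well defined and a homeomorphism is
  shown in \<open>KQ_ident_class\<close> and \<open>homeomorphic_map_KQ_ident\<close> below.
\<close>

definition KQ_ident :: "('a, 'm) ring_scheme \<Rightarrow> 'a set \<Rightarrow> 'a set" where
  "KQ_ident R p =
     (THE J. \<exists>a\<in>nonzero_nonunits R.
        p = Kolmogorov_quotient (GD R) (assoc_class R a) \<and> J = radical R (PIdl\<^bsub>R\<^esub> a))"


section \<open>Posets\<close>

definition order_embedding_on :: "'a::order set \<Rightarrow> 'b::order set \<Rightarrow> ('a \<Rightarrow> 'b) \<Rightarrow> bool" where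
  "order_embedding_on P Q \<phi> \<longleftrightarrow>
     \<phi> ` P \<subseteq> Q \<and> (\<forall>x\<in>P. \<forall>y\<in>P. x \<le> y \<longleftrightarrow> \<phi> x \<le> \<phi> y)"

definition upper_alexandrov :: "'a::order set \<Rightarrow> 'a topology" where
  "upper_alexandrov P = topology (\<lambda>U. U \<subseteq> P \<and> (\<forall>x\<in>U. \<forall>y\<in>P. x \<le> y \<longrightarrow> y \<in> U))"

definition ring_preimage :: "('a, 'm) ring_scheme \<Rightarrow> ('a \<Rightarrow> 'b) \<Rightarrow> 'b set \<Rightarrow> 'a set" where
  "ring_preimage A f J = {x \<in> carrier A. f x \<in> J}"


section \<open>The topology has the stated basis, and the identification is a homeomorphism\<close>

lemma openin_upper_alexandrov:
  "openin (upper_alexandrov P) U \<longleftrightarrow> U \<subseteq> P \<and> (\<forall>x\<in>U. \<forall>y\<in>P. x \<le> y \<longrightarrow> y \<in> U)"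
proof -
  have "istopology (\<lambda>U. U \<subseteq> P \<and> (\<forall>x\<in>U. \<forall>y\<in>P. x \<le> y \<longrightarrow> y \<in> U))"
    unfolding istopology_def by blast
  then show ?thesis
    by (simp add: upper_alexandrov_def topology_inverse')
qed

lemma topspace_upper_alexandrov: "topspace (upper_alexandrov P) = P"
  by (auto simp: topspace_def openin_upper_alexandrov)

lemma nonzero_nonunits_carrier: "a \<in> nonzero_nonunits R \<Longrightarrow> a \<in> carrier R"
  by (simp add: nonzero_nonunits_def)

lemma divides_iff_mem_PIdl:
  assumes "cring R" "b \<in> carrier R"
  shows "b divides\<^bsub>R\<^esub> c \<longleftrightarrow> c \<in> PIdl\<^bsub>R\<^esub> b"
proof -
  interpret cring R by fact
  show ?thesis
    using assms(2) by (auto simp: factor_def cgenideal_def m_comm)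
qed

lemma radical_PIdl_subset_iff:
  assumes R: "cring R" and a: "a \<in> carrier R" and b: "b \<in> carrier R"
  shows "radical R (PIdl\<^bsub>R\<^esub> a) \<subseteq> radical R (PIdl\<^bsub>R\<^esub> b) \<longleftrightarrow>
    (\<exists>n::nat. n \<ge> 1 \<and> b divides\<^bsub>R\<^esub> (a [^]\<^bsub>R\<^esub> n))"
proof -
  interpret cring R by fact
  show ?thesis
  proof
    assume L: "radical R (PIdl\<^bsub>R\<^esub> a) \<subseteq> radical R (PIdl\<^bsub>R\<^esub> b)"
    have "a [^]\<^bsub>R\<^esub> (1::nat) \<in> PIdl\<^bsub>R\<^esub> a"
      using a cgenideal_self by simp
    then have "a \<in> radical R (PIdl\<^bsub>R\<^esub> a)"
      using a unfolding radical_def by blast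
    then have "a \<in> radical R (PIdl\<^bsub>R\<^esub> b)" using L by blast
    then show "\<exists>n::nat. n \<ge> 1 \<and> b divides\<^bsub>R\<^esub> (a [^]\<^bsub>R\<^esub> n)"
      using divides_iff_mem_PIdl[OF R b] by (auto simp: radical_def)
  next
    assume "\<exists>n::nat. n \<ge> 1 \<and> b divides\<^bsub>R\<^esub> (a [^]\<^bsub>R\<^esub> n)"
    then obtain n :: nat where n: "n \<ge> 1" "b divides\<^bsub>R\<^esub> (a [^]\<^bsub>R\<^esub> n)" by blast
    show "radical R (PIdl\<^bsub>R\<^esub> a) \<subseteq> radical R (PIdl\<^bsub>R\<^esub> b)"
    proof
      fix x assume "x \<in> radical R (PIdl\<^bsub>R\<^esub> a)"
      then obtain m :: nat where x: "x \<in> carrier R" "m \<ge> 1" "x [^]\<^bsub>R\<^esub> m \<in> PIdl\<^bsub>R\<^esub> a"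
        by (auto simp: radical_def)
      then obtain r where r: "r \<in> carrier R" "x [^]\<^bsub>R\<^esub> m = r \<otimes>\<^bsub>R\<^esub> a"
        by (auto simp: cgenideal_def)
      have "x [^]\<^bsub>R\<^esub> (m * n) = r [^]\<^bsub>R\<^esub> n \<otimes>\<^bsub>R\<^esub> a [^]\<^bsub>R\<^esub> n"
        using r a x(1) by (metis nat_pow_distrib nat_pow_pow)
      moreover have "b divides\<^bsub>R\<^esub> (r [^]\<^bsub>R\<^esub> n \<otimes>\<^bsub>R\<^esub> a [^]\<^bsub>R\<^esub> n)"
        using n(2) r(1) a b by (metis divides_prod_l nat_pow_closed)
      ultimately have "x [^]\<^bsub>R\<^esub> (m * n) \<in> PIdl\<^bsub>R\<^esub> b"
        using divides_iff_mem_PIdl[OF R b] by simp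
      moreover have "m * n \<ge> 1" using x(2) n(1) by simp
      ultimately show "x \<in> radical R (PIdl\<^bsub>R\<^esub> b)"
        using x(1) unfolding radical_def by blast
    qed
  qed
qed

lemma assoc_class_eqD:
  assumes "a \<in> nonzero_nonunits R" "b \<in> nonzero_nonunits R" "assoc_class R a = assoc_class R b"
  shows "PIdl\<^bsub>R\<^esub> a = PIdl\<^bsub>R\<^esub> b"
proof -
  have "b \<in> assoc_class R a"
    using assms(2) unfolding assms(3) by (simp add: assoc_class_def)
  then show ?thesis by (simp add: assoc_class_def)
qed

lemma assoc_class_mem_GD_basic_iff:
  assumes R: "cring R" and a: "a \<in> nonzero_nonunits R" and b: "b \<in> nonzero_nonunits R"
  shows "assoc_class R b \<in> GD_basic R a \<longleftrightarrow>
    radical R (PIdl\<^bsub>R\<^esub> a) \<subseteq> radical R (PIdl\<^bsub>R\<^esub> b)"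
proof -
  have sub: "(\<exists>n::nat. n \<ge> 1 \<and> c divides\<^bsub>R\<^esub> (a [^]\<^bsub>R\<^esub> n)) \<longleftrightarrow>
      radical R (PIdl\<^bsub>R\<^esub> a) \<subseteq> radical R (PIdl\<^bsub>R\<^esub> c)" if "c \<in> nonzero_nonunits R" for c
    by (rule radical_PIdl_subset_iff[symmetric, OF R nonzero_nonunits_carrier[OF a]
          nonzero_nonunits_carrier[OF that]])
  show ?thesis
  proof
    assume "assoc_class R b \<in> GD_basic R a"
    then obtain c where c: "assoc_class R b = assoc_class R c" "c \<in> nonzero_nonunits R"
        "\<exists>n::nat. n \<ge> 1 \<and> c divides\<^bsub>R\<^esub> (a [^]\<^bsub>R\<^esub> n)"
      unfolding GD_basic_def by blast
    have "PIdl\<^bsub>R\<^esub> b = PIdl\<^bsub>R\<^esub> c"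
      by (rule assoc_class_eqD[OF b c(2,1)])
    then show "radical R (PIdl\<^bsub>R\<^esub> a) \<subseteq> radical R (PIdl\<^bsub>R\<^esub> b)"
      using sub[OF c(2)] c(3) by simp
  next
    assume "radical R (PIdl\<^bsub>R\<^esub> a) \<subseteq> radical R (PIdl\<^bsub>R\<^esub> b)"
    then show "assoc_class R b \<in> GD_basic R a"
      using sub[OF b] b unfolding GD_basic_def by blast
  qed
qed

lemma GD_basic_subset_EC: "GD_basic R a \<subseteq> EC R"
  by (auto simp: GD_basic_def EC_def)

lemma openin_GD_basic:
  "a \<in> nonzero_nonunits R \<Longrightarrow> openin (GD R) (GD_basic R a)"
  unfolding GD_def by (rule topology_generated_by_Basis) simp

lemma openin_GD_iff:
  assumes R: "cring R"
  shows "openin (GD R) U \<longleftrightarrow>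
    U \<subseteq> EC R \<and> (\<forall>a\<in>nonzero_nonunits R. assoc_class R a \<in> U \<longrightarrow> GD_basic R a \<subseteq> U)"
proof
  assume "openin (GD R) U"
  then have "generate_topology_on (GD_basic R ` nonzero_nonunits R) U"
    by (simp add: GD_def openin_topology_generated_by_iff)
  then show "U \<subseteq> EC R \<and> (\<forall>a\<in>nonzero_nonunits R. assoc_class R a \<in> U \<longrightarrow> GD_basic R a \<subseteq> U)"
  proof induction
    case (Basis s)
    then obtain b where b: "b \<in> nonzero_nonunits R" "s = GD_basic R b" by blast
    have "GD_basic R a \<subseteq> s"
      if a: "a \<in> nonzero_nonunits R" "assoc_class R a \<in> s" for a
    proof
      fix p assume p: "p \<in> GD_basic R a"
      then obtain c where c: "c \<in> nonzero_nonunits R" "p = assoc_class R c"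
        using GD_basic_subset_EC by (force simp: EC_def)
      have "radical R (PIdl\<^bsub>R\<^esub> b) \<subseteq> radical R (PIdl\<^bsub>R\<^esub> a)"
        using a b assoc_class_mem_GD_basic_iff[OF R b(1) a(1)] by simp
      also have "\<dots> \<subseteq> radical R (PIdl\<^bsub>R\<^esub> c)"
        using p c assoc_class_mem_GD_basic_iff[OF R a(1) c(1)] by simp
      finally show "p \<in> s"
        using b c assoc_class_mem_GD_basic_iff[OF R b(1) c(1)] by simp
    qed
    then show ?case using GD_basic_subset_EC[of R b] b(2) by simp
  next
    case (Int s t)
    then show ?case by (simp add: le_infI1)
  next
    case (UN K)
    then show ?case by (meson Sup_least Sup_upper UnionE order_trans)
  qed simp
next
  assume U: "U \<subseteq> EC R \<and> (\<forall>a\<in>nonzero_nonunits R. assoc_class R a \<in> U \<longrightarrow> GD_basic R a \<subseteq> U)"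
  have "assoc_class R a \<in> GD_basic R a" if "a \<in> nonzero_nonunits R" for a
    using assoc_class_mem_GD_basic_iff[OF R that that] by simp
  note self = this
  show "openin (GD R) U"
  proof (subst openin_subopen, intro ballI)
    fix p assume p: "p \<in> U"
    then obtain a where a: "a \<in> nonzero_nonunits R" "p = assoc_class R a"
      using U by (auto simp: EC_def)
    then have "openin (GD R) (GD_basic R a) \<and> p \<in> GD_basic R a \<and> GD_basic R a \<subseteq> U"
      using U p self openin_GD_basic by simp
    then show "\<exists>T. openin (GD R) T \<and> p \<in> T \<and> T \<subseteq> U" by blast
  qed
qed

lemma topspace_GD:
  assumes R: "cring R"
  shows "topspace (GD R) = EC R"
proof (rule subset_antisym)
  show "topspace (GD R) \<subseteq> EC R"
    using openin_GD_iff[OF R, THEN iffD1, OF openin_topspace] by (rule conjunct1)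
  have "openin (GD R) (EC R)"
    unfolding openin_GD_iff[OF R] using GD_basic_subset_EC[of R] by simp
  then show "EC R \<subseteq> topspace (GD R)" by (rule openin_subset)
qed

lemma GD_basis:
  assumes R: "cring R"
  shows "openin (GD R) = arbitrary union_of (\<lambda>V. V \<in> GD_basic R ` nonzero_nonunits R)"
  unfolding openin_topology_base_unique
proof (intro conjI allI impI)
  fix V assume "V \<in> GD_basic R ` nonzero_nonunits R"
  then show "openin (GD R) V" by (auto intro: openin_GD_basic)
next
  fix U x assume "openin (GD R) U \<and> x \<in> U"
  then obtain a where a: "a \<in> nonzero_nonunits R" "x = assoc_class R a" "GD_basic R a \<subseteq> U"
    unfolding openin_GD_iff[OF R] EC_def by blast
  moreover have "x \<in> GD_basic R a"
    using a assoc_class_mem_GD_basic_iff[OF R] by simp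
  ultimately show "\<exists>V. V \<in> GD_basic R ` nonzero_nonunits R \<and> x \<in> V \<and> V \<subseteq> U" by blast
qed

lemma Kolmogorov_quotient_GD_eq_iff:
  assumes R: "cring R" and a: "a \<in> nonzero_nonunits R" and b: "b \<in> nonzero_nonunits R"
  shows "Kolmogorov_quotient (GD R) (assoc_class R a) = Kolmogorov_quotient (GD R) (assoc_class R b)
    \<longleftrightarrow> radical R (PIdl\<^bsub>R\<^esub> a) = radical R (PIdl\<^bsub>R\<^esub> b)"
proof
  assume "Kolmogorov_quotient (GD R) (assoc_class R a) = Kolmogorov_quotient (GD R) (assoc_class R b)"
  then have "assoc_class R a \<in> U \<longleftrightarrow> assoc_class R b \<in> U" if "openin (GD R) U" for U
    using that by (simp add: Kolmogorov_quotient_eq)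
  then show "radical R (PIdl\<^bsub>R\<^esub> a) = radical R (PIdl\<^bsub>R\<^esub> b)"
    using openin_GD_basic[OF a] openin_GD_basic[OF b]
      assoc_class_mem_GD_basic_iff[OF R a a] assoc_class_mem_GD_basic_iff[OF R a b]
      assoc_class_mem_GD_basic_iff[OF R b a] assoc_class_mem_GD_basic_iff[OF R b b]
    by (simp add: subset_antisym)
next
  assume e: "radical R (PIdl\<^bsub>R\<^esub> a) = radical R (PIdl\<^bsub>R\<^esub> b)"
  have ab: "assoc_class R a \<in> GD_basic R b" "assoc_class R b \<in> GD_basic R a"
    using e a b assoc_class_mem_GD_basic_iff[OF R] by simp_all
  show "Kolmogorov_quotient (GD R) (assoc_class R a) = Kolmogorov_quotient (GD R) (assoc_class R b)"
    unfolding Kolmogorov_quotient_eq openin_GD_iff[OF R] using ab a b by blast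
qed

lemma KQ_ident_class:
  assumes R: "cring R" and a: "a \<in> nonzero_nonunits R"
  shows "KQ_ident R (Kolmogorov_quotient (GD R) (assoc_class R a)) = radical R (PIdl\<^bsub>R\<^esub> a)"
  unfolding KQ_ident_def
proof (rule the_equality)
  fix J
  assume "\<exists>b\<in>nonzero_nonunits R. Kolmogorov_quotient (GD R) (assoc_class R a) =
            Kolmogorov_quotient (GD R) (assoc_class R b) \<and> J = radical R (PIdl\<^bsub>R\<^esub> b)"
  then show "J = radical R (PIdl\<^bsub>R\<^esub> a)"
    using Kolmogorov_quotient_GD_eq_iff[OF R a] by auto
qed (use a in auto)

lemma homeomorphic_map_KQ_ident:
  assumes R: "cring R"
  shows "homeomorphic_map (KQ (GD R)) (upper_alexandrov (principal_radicals R)) (KQ_ident R)"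
proof -
  let ?k = "\<lambda>a. Kolmogorov_quotient (GD R) (assoc_class R a)"
  let ?N = "nonzero_nonunits R"
  let ?r = "\<lambda>a. radical R (PIdl\<^bsub>R\<^esub> a)"
  have top: "topspace (KQ (GD R)) = ?k ` ?N"
    using Kolmogorov_quotient_in_topspace[of "GD R"]
    by (auto simp: KQ_def topspace_GD[OF R] EC_def)
  have q: "quotient_map (GD R) (KQ (GD R)) (Kolmogorov_quotient (GD R))"
    unfolding KQ_def by (rule quotient_map_Kolmogorov_quotient)
  have "quotient_map (GD R) (upper_alexandrov (principal_radicals R))
          (KQ_ident R \<circ> Kolmogorov_quotient (GD R))"
    unfolding quotient_map_def topspace_upper_alexandrov topspace_GD[OF R]
  proof (intro conjI allI impI)
    show "(KQ_ident R \<circ> Kolmogorov_quotient (GD R)) ` EC R = principal_radicals R"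
      using KQ_ident_class[OF R] by (force simp: EC_def principal_radicals_def)
  next
    fix U assume U: "U \<subseteq> principal_radicals R"
    have pre: "{x. x \<in> EC R \<and> (KQ_ident R \<circ> Kolmogorov_quotient (GD R)) x \<in> U}
      = assoc_class R ` {a \<in> ?N. ?r a \<in> U}" (is "?P = _")
      using KQ_ident_class[OF R] by (force simp: EC_def)
    have mem: "assoc_class R a \<in> ?P \<longleftrightarrow> ?r a \<in> U" if "a \<in> ?N" for a
      using that KQ_ident_class[OF R that] by (auto simp: EC_def)
    have "openin (GD R) ?P \<longleftrightarrow> (\<forall>a\<in>?N. ?r a \<in> U \<longrightarrow> GD_basic R a \<subseteq> ?P)"
      unfolding openin_GD_iff[OF R] using mem by blast
    also have "\<dots> \<longleftrightarrow> (\<forall>a\<in>?N. ?r a \<in> U \<longrightarrow> (\<forall>b\<in>?N. ?r a \<subseteq> ?r b \<longrightarrow> ?r b \<in> U))"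
    proof -
      have "GD_basic R a \<subseteq> ?P \<longleftrightarrow> (\<forall>b\<in>?N. ?r a \<subseteq> ?r b \<longrightarrow> ?r b \<in> U)" if a: "a \<in> ?N" for a
      proof -
        have "GD_basic R a \<subseteq> ?P \<longleftrightarrow>
            (\<forall>b\<in>?N. assoc_class R b \<in> GD_basic R a \<longrightarrow> assoc_class R b \<in> ?P)"
          using GD_basic_subset_EC[of R a] unfolding EC_def by blast
        then show ?thesis
          using mem assoc_class_mem_GD_basic_iff[OF R a] by blast
      qed
      then show ?thesis by blast
    qed
    also have "\<dots> \<longleftrightarrow> openin (upper_alexandrov (principal_radicals R)) U"
      unfolding openin_upper_alexandrov using U unfolding principal_radicals_def by blast
    finally show "openin (GD R) ?P = openin (upper_alexandrov (principal_radicals R)) U" .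
  qed
  then have "quotient_map (KQ (GD R)) (upper_alexandrov (principal_radicals R)) (KQ_ident R)"
    using quotient_map_compose_eq[OF q] by blast
  moreover have "inj_on (KQ_ident R) (topspace (KQ (GD R)))"
    unfolding top inj_on_def
    using KQ_ident_class[OF R] Kolmogorov_quotient_GD_eq_iff[OF R] by auto
  ultimately show ?thesis by (simp add: homeomorphic_map_def)
qed

end

theory Submission
  imports Defs
begin

text \<open>
  Everything rests on one equality: if \<open>f: A \<rightarrow> B\<close> is surjective with nil kernel, then
  \<open>f\<inverse>(\<surd>(f(a)B)) = \<surd>(aA)\<close> for \<^emph>\<open>every\<close> \<open>a \<in> A\<close>
  (\<open>preimage_radical_cgenideal\<close>). Indeed, if \<open>f(u)\<^sup>n = f(c) f(a)\<close>, then
  \<open>u\<^sup>n - ca\<close> lies in the kernel, so some power of it vanishes; modulo \<open>aA\<close> that power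
  is a power of \<open>u\<close>.

  The extreme values of \<open>a\<close> matter too. A unit \<open>a\<close> is an element with
  \<open>1 \<in> \<surd>(aA)\<close>, so \<open>f\<close> preserves and reflects units; and for \<open>a = 0\<close> the equality says that the
  preimage of \<open>Nil(B)\<close> is \<open>Nil(A)\<close>. Consequently the image of \<open>\<Phi>\<^sub>f\<close> consists of the radicals
  \<open>\<surd>(aA)\<close> with \<open>a\<close> a nonunit and \<open>f(a) \<noteq> 0\<close>. A nonzero nonunit \<open>a\<close> violating this lies in the
  kernel, so it is nilpotent and \<open>\<surd>(aA) = Nil(A)\<close>; hence \<open>Nil(A)\<close> is the only element that the
  image can miss. Since a ring has \<open>Nil\<close> among its principal radicals exactly when it has a
  nonzero nilpotent (\<open>nilradical_mem_principal_radicals_iff\<close>), and \<open>\<Phi>\<^sub>f\<close> is injective with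
  \<open>\<Phi>\<^sub>f(Nil(B)) = Nil(A)\<close>, it is missed precisely when \<open>A\<close> is not reduced and \<open>B\<close> is.

  As \<open>f\<close> is onto, taking preimages reflects inclusions, so \<open>\<Phi>\<^sub>f\<close> is an order embedding; and an
  order embedding is a topological embedding for the upper Alexandrov topologies
  (\<open>embedding_map_upper_alexandrov\<close>). Transporting it along the homeomorphisms \<open>KQ_ident\<close>
  gives the embedding of Kolmogorov quotients.
\<close>

section \<open>Order embeddings and Alexandrov topologies\<close>

lemma order_embedding_on_inj:
  assumes "order_embedding_on P Q \<phi>"
  shows "inj_on \<phi> P"
  using assms unfolding order_embedding_on_def by (intro inj_onI order.antisym) simp_all

text \<open>
  An upper set \<open>U\<close> of \<open>P\<close> is carried to the trace on \<open>\<phi>(P)\<close> of the upper set of \<open>Q\<close> generated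
  by \<open>\<phi>(U)\<close>: no further points of \<open>\<phi>(P)\<close> are added, because \<open>\<phi>\<close> reflects the order.
\<close>

lemma embedding_map_upper_alexandrov:
  assumes emb: "order_embedding_on P Q \<phi>"
  shows "embedding_map (upper_alexandrov P) (upper_alexandrov Q) \<phi>"
proof -
  let ?Y = "subtopology (upper_alexandrov Q) (\<phi> ` P)"
  have sub: "\<phi> ` P \<subseteq> Q"
    and le: "\<And>x y. x \<in> P \<Longrightarrow> y \<in> P \<Longrightarrow> \<phi> x \<le> \<phi> y \<longleftrightarrow> x \<le> y"
    using emb unfolding order_embedding_on_def by blast+
  have top: "topspace ?Y = \<phi> ` P"
    using sub by (auto simp: topspace_upper_alexandrov)
  have "continuous_map (upper_alexandrov P) (upper_alexandrov Q) \<phi>"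
    unfolding continuous_map topspace_upper_alexandrov openin_upper_alexandrov
    using sub le by auto
  then have "continuous_map (upper_alexandrov P) ?Y \<phi>"
    by (simp add: continuous_map_in_subtopology topspace_upper_alexandrov)
  moreover have "open_map (upper_alexandrov P) ?Y \<phi>"
    unfolding open_map_def
  proof (intro allI impI)
    fix U assume "openin (upper_alexandrov P) U"
    then have U: "U \<subseteq> P" "\<And>x y. x \<in> U \<Longrightarrow> y \<in> P \<Longrightarrow> x \<le> y \<Longrightarrow> y \<in> U"
      by (auto simp: openin_upper_alexandrov)
    let ?V = "{q \<in> Q. \<exists>x\<in>U. \<phi> x \<le> q}"
    have "openin (upper_alexandrov Q) ?V"
      unfolding openin_upper_alexandrov by (auto intro: order.trans)
    moreover have "\<phi> ` U = ?V \<inter> \<phi> ` P"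
    proof
      show "\<phi> ` U \<subseteq> ?V \<inter> \<phi> ` P"
        using U(1) sub by auto
      show "?V \<inter> \<phi> ` P \<subseteq> \<phi> ` U"
        using U le by blast
    qed
    ultimately show "openin ?Y (\<phi> ` U)"
      by (auto simp: openin_subtopology)
  qed
  ultimately have "homeomorphic_map (upper_alexandrov P) ?Y \<phi>"
    by (rule bijective_open_imp_homeomorphic_map)
      (use top order_embedding_on_inj[OF emb] in \<open>simp_all add: topspace_upper_alexandrov\<close>)
  then show ?thesis
    by (simp add: embedding_map_def topspace_upper_alexandrov)
qed

lemma homeomorphic_map_imp_embedding_map:
  assumes "homeomorphic_map X Y h"
  shows "embedding_map X Y h"
  using assms homeomorphic_imp_surjective_map[OF assms] by (simp add: embedding_map_def)

section \<open>Radicals of principal ideals\<close>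

lemma mem_radical_PIdl_iff:
  "x \<in> radical R (PIdl\<^bsub>R\<^esub> a) \<longleftrightarrow>
    x \<in> carrier R \<and> (\<exists>n::nat. n \<ge> 1 \<and> (\<exists>c\<in>carrier R. x [^]\<^bsub>R\<^esub> n = c \<otimes>\<^bsub>R\<^esub> a))"
  unfolding radical_def cgenideal_def by blast

lemma mem_nilradical_iff:
  "x \<in> nilradical R \<longleftrightarrow> x \<in> carrier R \<and> (\<exists>n::nat. n \<ge> 1 \<and> x [^]\<^bsub>R\<^esub> n = \<zero>\<^bsub>R\<^esub>)"
  unfolding nilradical_def radical_def by blast

lemma radical_subset_carrier: "radical R I \<subseteq> carrier R"
  unfolding radical_def by blast

lemma mem_principal_radicals_subset_carrier:
  assumes "J \<in> principal_radicals R"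
  shows "J \<subseteq> carrier R"
  using assms radical_subset_carrier[of R] unfolding principal_radicals_def by blast

lemma (in ideal) mem_radical_self:
  assumes "x \<in> I"
  shows "x \<in> radical R I"
proof -
  have "x \<in> carrier R"
    using assms a_subset by blast
  then have "x [^] (1::nat) \<in> I"
    using assms by simp
  then show ?thesis
    using \<open>x \<in> carrier R\<close> unfolding radical_def by blast
qed

lemma (in cring) nilradical_eq_radical_PIdl_zero: "nilradical R = radical R (PIdl \<zero>)"
proof -
  have "PIdl \<zero> = {\<zero>}"
    unfolding cgenideal_def by force
  then show ?thesis
    by (simp add: nilradical_def)
qed

lemma (in cring) Units_iff_one_mem_radical:
  assumes "a \<in> carrier R"
  shows "a \<in> Units R \<longleftrightarrow> \<one> \<in> radical R (PIdl a)"
proof -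
  have "\<one> \<in> radical R (PIdl a) \<longleftrightarrow> \<one> \<in> PIdl a"
    unfolding radical_def by auto
  then show ?thesis
    using Unit_eq_dividesone[OF assms] divides_iff_mem_PIdl[OF is_cring assms] by simp
qed

lemma (in cring) radical_eq_nilradical_iff:
  assumes a: "a \<in> carrier R"
  shows "radical R (PIdl a) = nilradical R \<longleftrightarrow> a \<in> nilradical R"
proof
  interpret I: ideal "PIdl a" R
    using a by (rule cgenideal_ideal)
  have "a \<in> radical R (PIdl a)"
    using I.mem_radical_self cgenideal_self[OF a] by simp
  then show "radical R (PIdl a) = nilradical R \<Longrightarrow> a \<in> nilradical R"
    by simp
next
  assume "a \<in> nilradical R"
  then obtain n :: nat where n: "n \<ge> 1" "a [^] n = \<zero>"
    by (auto simp: nilradical_def radical_def)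
  have "a divides (\<zero> [^] (1::nat))"
    using a by (intro dividesI[of \<zero>]) simp_all
  moreover have "\<zero> divides (a [^] n)"
    using n by (intro dividesI[of \<zero>]) simp_all
  ultimately show "radical R (PIdl a) = nilradical R"
    using n(1) a unfolding nilradical_eq_radical_PIdl_zero
    by (intro subset_antisym) (auto simp only: radical_PIdl_subset_iff[OF is_cring] zero_closed)
qed

text \<open>
  A radical \<open>\<surd>(aR)\<close> contains \<open>a\<close>, so it is \<open>Nil(R)\<close> only for nilpotent \<open>a\<close>; conversely a
  nonzero nilpotent is a nonzero nonunit generating an ideal with radical \<open>Nil(R)\<close>.
\<close>

lemma (in cring) nilradical_mem_principal_radicals_iff:
  assumes "\<one> \<noteq> \<zero>"
  shows "nilradical R \<in> principal_radicals R \<longleftrightarrow> \<not> reduced_ring R"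
proof -
  have zero: "\<zero> \<in> nilradical R"
    using radical_eq_nilradical_iff[OF zero_closed] nilradical_eq_radical_PIdl_zero by simp
  have nonunit: "a \<notin> Units R" if "a \<in> nilradical R" for a
  proof
    assume "a \<in> Units R"
    have "a \<in> carrier R"
      using that by (simp add: mem_nilradical_iff)
    then have "\<one> \<in> nilradical R"
      using \<open>a \<in> Units R\<close> that Units_iff_one_mem_radical radical_eq_nilradical_iff by metis
    then show False
      using assms by (simp add: nilradical_def radical_def)
  qed
  have "nilradical R \<in> principal_radicals R \<longleftrightarrow> (\<exists>a \<in> nonzero_nonunits R. a \<in> nilradical R)"
    unfolding principal_radicals_def mem_Collect_eq
    using radical_eq_nilradical_iff nonzero_nonunits_carrier by metis
  also have "\<dots> \<longleftrightarrow> (\<exists>a \<in> nilradical R. a \<noteq> \<zero>)"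
    using nonunit by (auto simp: nonzero_nonunits_def nilradical_def radical_def)
  also have "\<dots> \<longleftrightarrow> \<not> reduced_ring R"
    using zero by (auto simp: reduced_ring_def)
  finally show ?thesis .
qed

lemma (in cring) diff_mult_telescope:
  assumes "p \<in> carrier R" "q \<in> carrier R" "x \<in> carrier R" "y \<in> carrier R"
  shows "p \<otimes> x \<ominus> q \<otimes> y = p \<otimes> (x \<ominus> y) \<oplus> (p \<ominus> q) \<otimes> y"
  using assms by (simp add: minus_eq l_distr r_distr l_minus r_minus a_assoc r_neg1)

lemma (in cring) diff_diff_cancel:
  assumes "p \<in> carrier R" "q \<in> carrier R"
  shows "p \<ominus> (p \<ominus> q) = q"
  using assms by algebra

text \<open>
  Congruence modulo an ideal passes to powers. It replaces the binomial expansion of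
  \<open>(u\<^sup>n - ca)\<^sup>m\<close> when \<open>u\<^sup>n\<close> is compared with a nilpotent modulo \<open>aR\<close>.
\<close>

lemma (in ideal) pow_diff_mem:
  assumes x: "x \<in> carrier R" and y: "y \<in> carrier R" and "cring R" and diff: "x \<ominus> y \<in> I"
  shows "x [^] (n::nat) \<ominus> y [^] n \<in> I"
proof (induction n)
  case 0
  show ?case
    by (simp add: minus_eq r_neg additive_subgroup.zero_closed[OF is_additive_subgroup])
next
  case (Suc n)
  interpret cring R by fact
  have p: "x [^] n \<in> carrier R" "y [^] n \<in> carrier R"
    using x y by simp_all
  have "x [^] Suc n \<ominus> y [^] Suc n = x [^] n \<otimes> (x \<ominus> y) \<oplus> (x [^] n \<ominus> y [^] n) \<otimes> y"
    using diff_mult_telescope[OF p x y] by simp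
  moreover have "x [^] n \<otimes> (x \<ominus> y) \<in> I" "(x [^] n \<ominus> y [^] n) \<otimes> y \<in> I"
    using p y diff Suc I_l_closed I_r_closed by simp_all
  ultimately show ?case
    by (simp add: a_closed)
qed

section \<open>Surjections with nil kernel\<close>

lemma mem_ring_preimage_iff: "x \<in> ring_preimage A f J \<longleftrightarrow> x \<in> carrier A \<and> f x \<in> J"
  unfolding ring_preimage_def by blast

text \<open>
  Preimages under a surjection reflect inclusion; this is why \<open>\<Phi>\<^sub>f\<close> reflects the order and is
  injective.
\<close>

lemma ring_preimage_subset_iff:
  assumes "J \<subseteq> f ` carrier A"
  shows "ring_preimage A f J \<subseteq> ring_preimage A f K \<longleftrightarrow> J \<subseteq> K"
proof
  show "J \<subseteq> K" if le: "ring_preimage A f J \<subseteq> ring_preimage A f K"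
  proof
    fix y assume "y \<in> J"
    then obtain x where "x \<in> carrier A" "y = f x"
      using assms by blast
    then show "y \<in> K"
      using \<open>y \<in> J\<close> le mem_ring_preimage_iff[of x A f] by blast
  qed
  show "ring_preimage A f J \<subseteq> ring_preimage A f K" if "J \<subseteq> K"
    using that unfolding ring_preimage_def by blast
qed

text \<open>
  The nil kernel is used for the inclusion from left to right: modulo \<open>aR\<close>, the element
  \<open>u\<^sup>n\<close> agrees with the nilpotent \<open>u\<^sup>n - ca\<close>. Surjectivity supplies the lift \<open>c\<close> of the cofactor.
\<close>

lemma (in ring_hom_cring) preimage_radical_cgenideal:
  assumes surj: "h ` carrier R = carrier S"
    and ker: "a_kernel R S h \<subseteq> nilradical R"
    and a: "a \<in> carrier R"
  shows "ring_preimage R h (radical S (PIdl\<^bsub>S\<^esub> (h a))) = radical R (PIdl a)"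
proof
  interpret I: ideal "PIdl a" R
    using a by (rule R.cgenideal_ideal)
  show "ring_preimage R h (radical S (PIdl\<^bsub>S\<^esub> (h a))) \<subseteq> radical R (PIdl a)"
  proof
    fix u assume "u \<in> ring_preimage R h (radical S (PIdl\<^bsub>S\<^esub> (h a)))"
    then obtain n :: nat and d where u: "u \<in> carrier R" and n: "n \<ge> 1"
      and "d \<in> carrier S" and d: "h u [^]\<^bsub>S\<^esub> n = d \<otimes>\<^bsub>S\<^esub> h a"
      unfolding mem_ring_preimage_iff mem_radical_PIdl_iff by blast
    then obtain c where c: "c \<in> carrier R" "h c = d"
      using surj by (metis imageE)
    define w where "w = u [^] n \<ominus> c \<otimes> a"
    have w: "w \<in> carrier R"
      using u c a by (simp add: w_def)
    have "h w = \<zero>\<^bsub>S\<^esub>"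
      using u c a d \<open>d \<in> carrier S\<close>
      by (simp add: w_def R.minus_eq S.r_neg ring.hom_nat_pow)
    then have "w \<in> nilradical R"
      using w ker unfolding a_kernel_def' by blast
    then obtain m :: nat where m: "m \<ge> 1" "w [^] m = \<zero>"
      unfolding mem_nilradical_iff by blast
    have "u [^] n \<ominus> w = c \<otimes> a"
      using u c a unfolding w_def by (intro R.diff_diff_cancel) simp_all
    then have "u [^] n \<ominus> w \<in> PIdl a"
      using c unfolding cgenideal_def by blast
    then have "(u [^] n) [^] m \<ominus> w [^] m \<in> PIdl a"
      using u w R.is_cring by (intro I.pow_diff_mem) simp_all
    then have "u [^] (n * m) \<in> PIdl a"
      using m u by (simp add: R.minus_eq R.nat_pow_pow)
    moreover have "n * m \<ge> 1"
      using n m by simp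
    ultimately show "u \<in> radical R (PIdl a)"
      using u unfolding radical_def by blast
  qed
  show "radical R (PIdl a) \<subseteq> ring_preimage R h (radical S (PIdl\<^bsub>S\<^esub> (h a)))"
  proof
    fix u assume "u \<in> radical R (PIdl a)"
    then obtain n :: nat and c where u: "u \<in> carrier R" "n \<ge> 1"
      and c: "c \<in> carrier R" "u [^] n = c \<otimes> a"
      unfolding mem_radical_PIdl_iff by blast
    have "h u [^]\<^bsub>S\<^esub> n = h c \<otimes>\<^bsub>S\<^esub> h a"
      using u c a ring.hom_nat_pow[of u n] by simp
    moreover have "h u \<in> carrier S" "h c \<in> carrier S"
      using u c by simp_all
    ultimately show "u \<in> ring_preimage R h (radical S (PIdl\<^bsub>S\<^esub> (h a)))"
      using u unfolding mem_ring_preimage_iff mem_radical_PIdl_iff by blast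
  qed
qed

lemma (in ring_hom_cring) preimage_nilradical:
  assumes "h ` carrier R = carrier S" and "a_kernel R S h \<subseteq> nilradical R"
  shows "ring_preimage R h (nilradical S) = nilradical R"
  using preimage_radical_cgenideal[OF assms R.zero_closed]
  unfolding R.nilradical_eq_radical_PIdl_zero S.nilradical_eq_radical_PIdl_zero hom_zero .

lemma (in ring_hom_cring) Units_image_iff:
  assumes "h ` carrier R = carrier S" and "a_kernel R S h \<subseteq> nilradical R"
    and a: "a \<in> carrier R"
  shows "h a \<in> Units S \<longleftrightarrow> a \<in> Units R"
proof -
  have "h a \<in> Units S \<longleftrightarrow> \<one>\<^bsub>S\<^esub> \<in> radical S (PIdl\<^bsub>S\<^esub> (h a))"
    using a by (intro S.Units_iff_one_mem_radical) simp
  also have "\<dots> \<longleftrightarrow> \<one> \<in> ring_preimage R h (radical S (PIdl\<^bsub>S\<^esub> (h a)))"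
    by (simp add: mem_ring_preimage_iff)
  also have "\<dots> \<longleftrightarrow> a \<in> Units R"
    using preimage_radical_cgenideal[OF assms] R.Units_iff_one_mem_radical[OF a] by simp
  finally show ?thesis .
qed

text \<open>
  Every nonzero nonunit of the codomain lifts, and each lift is a nonunit with nonzero image;
  the radical is then pulled back along the lift.
\<close>

lemma (in ring_hom_cring) image_preimage_principal_radicals:
  assumes surj: "h ` carrier R = carrier S" and ker: "a_kernel R S h \<subseteq> nilradical R"
  shows "ring_preimage R h ` principal_radicals S =
    {radical R (PIdl a) | a. a \<in> nonzero_nonunits R \<and> h a \<noteq> \<zero>\<^bsub>S\<^esub>}"
proof -
  let ?M = "{a \<in> nonzero_nonunits R. h a \<noteq> \<zero>\<^bsub>S\<^esub>}"
  have "h a \<in> nonzero_nonunits S \<longleftrightarrow> a \<in> ?M" if "a \<in> carrier R" for a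
    using that Units_image_iff[OF surj ker that] unfolding nonzero_nonunits_def
    by (cases "a = \<zero>") (simp_all, blast)
  moreover have "nonzero_nonunits S \<subseteq> h ` carrier R"
    unfolding surj nonzero_nonunits_def by blast
  ultimately have "nonzero_nonunits S = h ` ?M"
    using nonzero_nonunits_carrier[of _ R] by blast
  moreover have "principal_radicals S = (\<lambda>b. radical S (PIdl\<^bsub>S\<^esub> b)) ` nonzero_nonunits S"
    unfolding principal_radicals_def by blast
  ultimately have "principal_radicals S = (\<lambda>a. radical S (PIdl\<^bsub>S\<^esub> (h a))) ` ?M"
    by (simp only: image_image)
  then have "ring_preimage R h ` principal_radicals S =
      (\<lambda>a. ring_preimage R h (radical S (PIdl\<^bsub>S\<^esub> (h a)))) ` ?M"
    by (simp only: image_image)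
  also have "\<dots> = (\<lambda>a. radical R (PIdl a)) ` ?M"
    using preimage_radical_cgenideal[OF surj ker] nonzero_nonunits_carrier[of _ R]
    by (intro image_cong refl) blast
  finally show ?thesis
    by (simp only: setcompr_eq_image)
qed

lemma (in ring_hom_cring) order_embedding_preimage:
  assumes surj: "h ` carrier R = carrier S" and ker: "a_kernel R S h \<subseteq> nilradical R"
  shows "order_embedding_on (principal_radicals S) (principal_radicals R) (ring_preimage R h)"
  unfolding order_embedding_on_def
proof (intro conjI ballI)
  have "{radical R (PIdl a) | a. a \<in> nonzero_nonunits R \<and> h a \<noteq> \<zero>\<^bsub>S\<^esub>} \<subseteq> principal_radicals R"
    unfolding principal_radicals_def by blast
  then show "ring_preimage R h ` principal_radicals S \<subseteq> principal_radicals R"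
    unfolding image_preimage_principal_radicals[OF surj ker] .
next
  fix J K assume "J \<in> principal_radicals S" "K \<in> principal_radicals S"
  then have "J \<subseteq> h ` carrier R"
    unfolding surj by (intro mem_principal_radicals_subset_carrier)
  then show "J \<subseteq> K \<longleftrightarrow> ring_preimage R h J \<subseteq> ring_preimage R h K"
    by (rule ring_preimage_subset_iff[symmetric])
qed

text \<open>
  A radical outside the image comes from an \<open>a\<close> with \<open>h(a) = 0\<close>; such an \<open>a\<close> is nilpotent, so its
  radical is the nilradical.
\<close>

lemma (in ring_hom_cring) principal_radicals_diff_subset:
  assumes surj: "h ` carrier R = carrier S" and ker: "a_kernel R S h \<subseteq> nilradical R"
  shows "principal_radicals R - {nilradical R} \<subseteq> ring_preimage R h ` principal_radicals S"
proof
  fix J assume J: "J \<in> principal_radicals R - {nilradical R}"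
  then obtain a where a: "a \<in> nonzero_nonunits R" "J = radical R (PIdl a)"
    unfolding principal_radicals_def by blast
  have "a \<in> carrier R"
    using a(1) by (rule nonzero_nonunits_carrier)
  then have "a \<notin> nilradical R"
    using J a(2) R.radical_eq_nilradical_iff by simp
  then have "h a \<noteq> \<zero>\<^bsub>S\<^esub>"
    using ker \<open>a \<in> carrier R\<close> unfolding a_kernel_def' by blast
  then show "J \<in> ring_preimage R h ` principal_radicals S"
    using a unfolding image_preimage_principal_radicals[OF surj ker] by blast
qed

text \<open>
  Since \<open>\<Phi>\<^sub>h\<close> is injective and maps the nilradical of the codomain to that of the domain, it
  attains the latter only if the former is a principal radical.
\<close>

lemma (in ring_hom_cring) nilradical_mem_image_iff:
  assumes surj: "h ` carrier R = carrier S" and ker: "a_kernel R S h \<subseteq> nilradical R"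
    and "\<one>\<^bsub>S\<^esub> \<noteq> \<zero>\<^bsub>S\<^esub>"
  shows "nilradical R \<in> ring_preimage R h ` principal_radicals S \<longleftrightarrow> \<not> reduced_ring S"
proof -
  have "nilradical S \<in> principal_radicals S"
    if mem: "nilradical R \<in> ring_preimage R h ` principal_radicals S"
  proof -
    obtain J where J: "J \<in> principal_radicals S" "nilradical R = ring_preimage R h J"
      using mem by (rule imageE)
    have "J \<subseteq> h ` carrier R" "nilradical S \<subseteq> h ` carrier R"
      using mem_principal_radicals_subset_carrier[OF J(1)] radical_subset_carrier[of S "{\<zero>\<^bsub>S\<^esub>}"]
      unfolding surj nilradical_def by simp_all
    moreover have "ring_preimage R h J = ring_preimage R h (nilradical S)"
      using J(2) preimage_nilradical[OF surj ker] by simp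
    ultimately have "J = nilradical S"
      using ring_preimage_subset_iff[of J h R "nilradical S"]
        ring_preimage_subset_iff[of "nilradical S" h R J] by blast
    then show ?thesis
      using J(1) by simp
  qed
  moreover have "nilradical R \<in> ring_preimage R h ` principal_radicals S"
    if "nilradical S \<in> principal_radicals S"
    using imageI[OF that, of "ring_preimage R h"] unfolding preimage_nilradical[OF surj ker] .
  ultimately have "nilradical R \<in> ring_preimage R h ` principal_radicals S
      \<longleftrightarrow> nilradical S \<in> principal_radicals S"
    by (rule iffI)
  then show ?thesis
    using S.nilradical_mem_principal_radicals_iff[OF assms(3)] by simp
qed

section \<open>The induced embedding of Kolmogorov quotients\<close>

text \<open>
  The embedding is \<open>\<phi>\<close> conjugated by the identifications: first \<open>KQ_ident B\<close>, then \<open>\<phi>\<close>, then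
  the inverse \<open>k\<close> of \<open>KQ_ident A\<close>.
\<close>

lemma embedding_map_KQ_of_order_embedding:
  assumes A: "cring A" and B: "cring B"
    and emb: "order_embedding_on (principal_radicals B) (principal_radicals A) \<phi>"
  shows "\<exists>g. embedding_map (KQ (GD B)) (KQ (GD A)) g \<and>
    (\<forall>p \<in> topspace (KQ (GD B)). KQ_ident A (g p) = \<phi> (KQ_ident B p))"
proof -
  let ?UA = "upper_alexandrov (principal_radicals A)"
  let ?UB = "upper_alexandrov (principal_radicals B)"
  obtain k where k: "homeomorphic_map ?UA (KQ (GD A)) k"
    and inv: "\<And>J. J \<in> topspace ?UA \<Longrightarrow> KQ_ident A (k J) = J"
    using homeomorphic_map_maps[THEN iffD1, OF homeomorphic_map_KQ_ident[OF A]]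
    by (metis homeomorphic_maps_map)
  have hB: "homeomorphic_map (KQ (GD B)) ?UB (KQ_ident B)"
    using B by (rule homeomorphic_map_KQ_ident)
  have "embedding_map (KQ (GD B)) (KQ (GD A)) (k \<circ> (\<phi> \<circ> KQ_ident B))"
    by (rule embedding_map_compose[OF embedding_map_compose[OF
          homeomorphic_map_imp_embedding_map[OF hB] embedding_map_upper_alexandrov[OF emb]]
          homeomorphic_map_imp_embedding_map[OF k]])
  moreover have "KQ_ident A ((k \<circ> (\<phi> \<circ> KQ_ident B)) p) = \<phi> (KQ_ident B p)"
    if "p \<in> topspace (KQ (GD B))" for p
  proof -
    have "KQ_ident B p \<in> principal_radicals B"
      using that homeomorphic_imp_surjective_map[OF hB] by (auto simp: topspace_upper_alexandrov)
    then have "\<phi> (KQ_ident B p) \<in> topspace ?UA"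
      using emb by (auto simp: topspace_upper_alexandrov order_embedding_on_def)
    then show ?thesis
      by (simp add: inv)
  qed
  ultimately show ?thesis
    by blast
qed

theorem theorem5p5:
  fixes A :: "('a, 'm) ring_scheme" and B :: "('b, 'n) ring_scheme" and f :: "'a \<Rightarrow> 'b"
  assumes "cring A" and "\<one>\<^bsub>A\<^esub> \<noteq> \<zero>\<^bsub>A\<^esub>"
    and "cring B" and "\<one>\<^bsub>B\<^esub> \<noteq> \<zero>\<^bsub>B\<^esub>"
    and "f \<in> ring_hom A B"
    and "f ` carrier A = carrier B"
    and "a_kernel A B f \<subseteq> nilradical A"
  shows
    "order_embedding_on (principal_radicals B) (principal_radicals A) (ring_preimage A f)
     \<and> (\<exists>g. embedding_map (KQ (GD B)) (KQ (GD A)) g \<and>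
            (\<forall>p \<in> topspace (KQ (GD B)). KQ_ident A (g p) = ring_preimage A f (KQ_ident B p)))
     \<and> principal_radicals A - {nilradical A} \<subseteq> ring_preimage A f ` principal_radicals B
     \<and> (reduced_ring A \<or> \<not> reduced_ring B \<longrightarrow>
          ring_preimage A f ` principal_radicals B = principal_radicals A)
     \<and> (\<not> reduced_ring A \<and> reduced_ring B \<longrightarrow>
          ring_preimage A f ` principal_radicals B = principal_radicals A - {nilradical A})"
proof -
  interpret ring_hom_cring A B f
    using assms(1,3,5) by (simp add: ring_hom_cring_def ring_hom_cring_axioms_def)
  note surj = assms(6) and ker = assms(7)
  note emb = order_embedding_preimage[OF surj ker]
  note miss = principal_radicals_diff_subset[OF surj ker]
  have into: "ring_preimage A f ` principal_radicals B \<subseteq> principal_radicals A"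
    using emb by (simp add: order_embedding_on_def)
  have nilA: "nilradical A \<in> principal_radicals A \<longleftrightarrow> \<not> reduced_ring A"
    using assms(2) by (rule R.nilradical_mem_principal_radicals_iff)
  have nil_im: "nilradical A \<in> ring_preimage A f ` principal_radicals B \<longleftrightarrow> \<not> reduced_ring B"
    using surj ker assms(4) by (rule nilradical_mem_image_iff)
  have "ring_preimage A f ` principal_radicals B = principal_radicals A"
    if "reduced_ring A \<or> \<not> reduced_ring B"
    using that into miss nilA nil_im by blast
  moreover have "ring_preimage A f ` principal_radicals B = principal_radicals A - {nilradical A}"
    if "\<not> reduced_ring A \<and> reduced_ring B"
    using that into miss nil_im by blast
  ultimately show ?thesis
    using emb miss embedding_map_KQ_of_order_embedding[OF assms(1,3) emb] by blast
qed

end
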